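(* Let $l$ be a prime with $l\equiv7\pmod8$, $n=l+1$, coordinates of $\mathbf{R}^n$ indexed by $\infty,0,\ldots,l-1$, and $W$ the Paley matrix ($W_{\infty\infty}=0$, $W_{\infty j}=1$, $W_{j\infty}=-1$, $W_{ij}=\left(\frac{j-i}{l}\right)$ for $i,j\in\{0,\ldots,l-1\}$). Let $\mathcal{O}=\mathbf{Z}[\frac{1+\sqrt{-l}}{2}]$ act via $(r+s\sqrt{-l})\mathbf{v}=\mathbf{v}(rI+sW)$, $L_0=\{\mathbf{a}\in\mathbf{Z}^n:\sum a_\mu\equiv0\pmod2\}$, $L_+=L_0\cup(\tfrac12\mathbf{e}_\infty(I+W)+L_0)$, and $\mathcal{P}=\langle2,\tfrac12(1+\sqrt{-l})\rangle$. Let $\mathcal{D}$ be the extended binary quadratic residue code defined below. Then $\mathcal{P}L_+\cap\mathbf{Z}^n$ consists exactly of the vectors in $\mathbf{Z}^n$ that reduce modulo $2$ to elements of $\mathcal{D}$ and whose entries sum to a multiple of $4$; and $\mathcal{P}L_+$ is generated by $\mathcal{P}L_+\cap\mathbf{Z}^n$ together with the vector $\tfrac12(\tfrac12(1-l),1,1,\ldots,1)$ (first entry in the $\infty$ position).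
   Context: $\mathcal{P}L_+$ is the subgroup generated by $\alpha\mathbf{v}$, $\alpha\in\mathcal{P}$, $\mathbf{v}\in L_+$. Let $\zeta$ be a primitive $l$-th root of unity in an extension of $\mathbf{F}_2$, chosen so that $f_+(X)=\prod_{(j/l)=1}(X-\zeta^j)$ has coefficient $0$ at $X^{(l-3)/2}$, and let $f_-(X)=\prod_{(j/l)=-1}(X-\zeta^j)\in\mathbf{F}_2[X]$. $\mathcal{D}'$ is the binary cyclic code of length $l$ (coordinates $0,\ldots,l-1$, identified with $\mathbf{F}_2[X]/(X^l-1)$ via $(c_j)\mapsto\sum c_jX^j$) generated by $f_-(X)$, and $\mathcal{D}$ is obtained from $\mathcal{D}'$ by adding an overall parity-check bit in the $\infty$ coordinate. *)

theory Defs
  imports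
    "HOL-Analysis.Analysis"
    "HOL-Computational_Algebra.Group_Closure"
    "HOL-Number_Theory.Number_Theory"
    "HOL-Library.Z2"
    "Berlekamp_Zassenhaus.Finite_Field"
begin

unbundle no fps_syntax

text \<open>
  The prime \<open>l\<close> is \<open>CARD('p)\<close> for a type \<open>'p\<close> of prime cardinality.  The coordinates are indexed by
  \<open>'p mod_ring option\<close>: \<open>None\<close> is the coordinate \<open>\<infinity>\<close>, and \<open>Some i\<close> is the coordinate
  \<open>to_int_mod_ring i\<close>, which lies in \<open>{0, \<dots>, l - 1}\<close>.
\<close>

type_synonym 'p coord = "'p mod_ring option"

text \<open>\<open>paley $ \<mu> $ \<nu>\<close> is the entry in row \<open>\<mu>\<close> and column \<open>\<nu>\<close>.\<close>

definition paley :: "real ^ ('p::prime_card) coord ^ 'p coord" where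
  "paley = (\<chi> \<mu> \<nu>. case \<mu> of
      None \<Rightarrow> (case \<nu> of None \<Rightarrow> 0 | Some j \<Rightarrow> 1)
    | Some i \<Rightarrow> (case \<nu> of
          None \<Rightarrow> - 1
        | Some j \<Rightarrow> of_int (Legendre (to_int_mod_ring j - to_int_mod_ring i) (int CARD('p)))))"

text \<open>\<open>half_gen l\<close> is \<open>(1 + \<surd>(-l)) / 2\<close>, with \<open>\<surd>(-l) = \<i> \<surd>l\<close>.\<close>

definition half_gen :: "nat \<Rightarrow> complex" where
  "half_gen l = (1 + csqrt (- of_nat l)) / 2"

text \<open>The ring \<open>\<int>[(1 + \<surd>(-l)) / 2]\<close>: all values of integer polynomials at the generator.\<close>

definition quad_order :: "nat \<Rightarrow> complex set" where
  "quad_order l = {poly (map_poly of_int p) (half_gen l) | p :: int poly. True}"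

text \<open>The ideal of \<open>quad_order l\<close> generated by \<open>2\<close> and \<open>(1 + \<surd>(-l)) / 2\<close>.\<close>

definition ideal_P :: "nat \<Rightarrow> complex set" where
  "ideal_P l = {a * 2 + b * half_gen l | a b. a \<in> quad_order l \<and> b \<in> quad_order l}"

text \<open>
  For \<open>\<alpha> = r + s \<surd>(-l)\<close> with real \<open>r\<close> and \<open>s\<close> we have \<open>r = Re \<alpha>\<close> and \<open>s = Im \<alpha> / \<surd>l\<close>.
  Vectors are rows, so matrices act from the right.
\<close>

definition quad_act :: "complex \<Rightarrow> real ^ ('p::prime_card) coord \<Rightarrow> real ^ 'p coord" where
  "quad_act \<alpha> v = v v* (Re \<alpha> *\<^sub>R mat 1 + (Im \<alpha> / sqrt (real CARD('p))) *\<^sub>R paley)"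

text \<open>
  An integer vector viewed over another ring.  Over the reals this is the inclusion of the integer
  vectors, over \<open>bit\<close> it is reduction modulo 2.
\<close>

definition int_vec :: "int ^ 'n \<Rightarrow> ('a::ring_1) ^ 'n" where
  "int_vec a = (\<chi> \<mu>. of_int (a $ \<mu>))"

definition L_zero :: "(real ^ ('p::prime_card) coord) set" where
  "L_zero = int_vec ` {a :: int ^ 'p coord. even (\<Sum>\<mu>\<in>UNIV. a $ \<mu>)}"

definition L_plus :: "(real ^ ('p::prime_card) coord) set" where
  "L_plus = L_zero \<union> (+) ((1/2) *\<^sub>R (axis None 1 v* (mat 1 + paley))) ` L_zero"

definition PL_plus :: "(real ^ ('p::prime_card) coord) set" where
  "PL_plus = group_closure {quad_act \<alpha> v | \<alpha> v. \<alpha> \<in> ideal_P CARD('p) \<and> v \<in> L_plus}"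

definition primitive_root_of_unity :: "nat \<Rightarrow> 'k::field \<Rightarrow> bool" where
  "primitive_root_of_unity l \<zeta> \<longleftrightarrow> \<zeta> ^ l = 1 \<and> (\<forall>k. 0 < k \<and> k < l \<longrightarrow> \<zeta> ^ k \<noteq> 1)"

text \<open>\<open>qr_poly l e \<zeta>\<close> is \<open>f\<^sub>+\<close> for \<open>e = 1\<close> and \<open>f\<^sub>-\<close> for \<open>e = -1\<close>, over the field containing \<open>\<zeta>\<close>.\<close>

definition qr_poly :: "nat \<Rightarrow> int \<Rightarrow> 'k::field \<Rightarrow> 'k poly" where
  "qr_poly l e \<zeta> = (\<Prod>j | j < l \<and> Legendre (int j) (int l) = e. [:- (\<zeta> ^ j), 1:])"

text \<open>The embedding of the prime field into a field of characteristic 2.\<close>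

definition bit_embed :: "bit \<Rightarrow> 'k::field" where
  "bit_embed b = (if b = 1 then 1 else 0)"

text \<open>
  The polynomial \<open>f\<^sub>-\<close> as an element of \<open>\<bbbF>\<^sub>2[X]\<close>: the preimage of \<open>qr_poly l (-1) \<zeta>\<close> under the
  embedding of coefficients, which is injective.
\<close>

definition f_minus :: "nat \<Rightarrow> 'k::field \<Rightarrow> bit poly" where
  "f_minus l \<zeta> = (THE g. map_poly bit_embed g = qr_poly l (- 1) \<zeta>)"

definition word_poly :: "bit ^ ('p::prime_card) mod_ring \<Rightarrow> bit poly" where
  "word_poly c = (\<Sum>j\<in>UNIV. Polynomial.monom (c $ j) (nat (to_int_mod_ring j)))"

text \<open>The ideal generated by \<open>g\<close> in \<open>\<bbbF>\<^sub>2[X] / (X\<^sup>l - 1)\<close>, as a set of words.\<close>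

definition cyclic_code :: "bit poly \<Rightarrow> (bit ^ ('p::prime_card) mod_ring) set" where
  "cyclic_code g = {c. \<exists>q. [word_poly c = q * g] (mod (Polynomial.monom 1 CARD('p) - 1))}"

definition parity_extend :: "bit ^ ('p::prime_card) mod_ring \<Rightarrow> bit ^ 'p coord" where
  "parity_extend c = (\<chi> \<mu>. case \<mu> of None \<Rightarrow> (\<Sum>j\<in>UNIV. c $ j) | Some j \<Rightarrow> c $ j)"

definition extended_qr_code :: "'k::field \<Rightarrow> (bit ^ ('p::prime_card) coord) set" where
  "extended_qr_code \<zeta> = parity_extend ` cyclic_code (f_minus CARD('p) \<zeta>)"

end

theory Submission
  imports Defs
begin

text \<open>
  Put \<open>\<omega> = (1 + \<surd>(-l)) / 2\<close>.  Since \<open>\<omega>\<^sup>2 = \<omega> - (l + 1) / 4\<close> and \<open>(l + 1) / 4\<close> is even, the ideal is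
  \<open>\<int> 2 + \<int> \<omega>\<close>, so \<open>\<P>L\<^sub>+\<close> is the group \<open>2 L\<^sub>+ + \<omega> L\<^sub>+\<close>.  Here \<open>\<omega>\<close> sends half the all-ones vector
  to the glue vector of the theorem, while \<open>2 L\<^sub>+ + \<omega> L\<^sub>0\<close> is integral and spanned by
  \<open>2 L\<^sub>0\<close>, the all-ones vector and the vectors \<open>\<omega> (e\<^sub>\<infinity> + e\<^sub>i)\<close>, which are the indicators of the
  translates \<open>i + {q. chi q \<noteq> -1}\<close>.  All of these have coordinate sum divisible by 4.

  It remains to see that these translates and the all-ones word span the quadratic residue code over
  \<open>\<bbbF>\<^sub>2\<close>.  The coefficient condition says that \<open>\<zeta>\<^sup>q\<close> sums to 0 over the residues \<open>q\<close>, hence to 1 over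
  the nonresidues, so the indicator of \<open>{q. chi q \<noteq> -1}\<close> has discrete Fourier transform 1 on the
  residues and 0 elsewhere.  Adding the all-ones word gives the idempotent of the code, and
  convolving a codeword with it writes the codeword in terms of the translates.
\<close>

subsection \<open>The quadratic character\<close>

definition chi :: "'p::prime_card mod_ring \<Rightarrow> int" where
  "chi x = Legendre (to_int_mod_ring x) (int CARD('p))"

lemma cong_to_int_of_int:
  "[to_int_mod_ring (of_int a :: 'p::prime_card mod_ring) = a] (mod int CARD('p))"
  by (auto simp: cong_def of_int_of_int_mod_ring of_int_mod_ring.rep_eq to_int_mod_ring.rep_eq)

lemma Legendre_cong:
  assumes "[a = b] (mod m)"
  shows "Legendre a m = Legendre b m"
proof -
  have "[x = a] (mod m) \<longleftrightarrow> [x = b] (mod m)" "[a = x] (mod m) \<longleftrightarrow> [b = x] (mod m)" for x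
    using assms by (auto simp: cong_def)
  then show ?thesis
    by (simp add: Legendre_def QuadRes_def)
qed

text \<open>Moves the entries of \<open>paley\<close> from integer representatives to the field,
  where sums can be reindexed by translation and scaling.\<close>

lemma Legendre_eq_chi: "Legendre a (int CARD('p::prime_card)) = chi (of_int a :: 'p mod_ring)"
  unfolding chi_def by (rule Legendre_cong) (simp add: cong_sym cong_to_int_of_int)

lemma of_int_to_int_mod_ring [simp]:
  "of_int (to_int_mod_ring x) = (x :: 'p::prime_card mod_ring)"
  by (simp add: of_int_of_int_mod_ring)

lemma chi_range: "chi x \<in> {-1, 0, 1}"
  by (simp add: chi_def Legendre_def)

lemma chi_zero [simp]: "chi 0 = 0"
  by (simp add: chi_def Legendre_def to_int_mod_ring.rep_eq zero_mod_ring.rep_eq)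

lemma chi_eq_0_iff [simp]: "chi x = 0 \<longleftrightarrow> x = 0"
proof
  assume "chi x = 0"
  then have "[to_int_mod_ring x = 0] (mod int CARD('a))"
    by (simp add: chi_def Legendre_def split: if_splits)
  then show "x = 0"
    by (metis of_int_0 of_int_to_int_mod_ring
      of_int_of_int_mod_ring of_int_mod_ring.abs_eq cong_def)
qed simp

lemma euler_chi:
  assumes "2 < CARD('p::prime_card)"
  shows "[chi (of_int a :: 'p mod_ring) = a ^ ((CARD('p) - 1) div 2)] (mod int CARD('p))"
  using euler_criterion[OF prime_card assms, of a] by (simp add: Legendre_eq_chi)

text \<open>Two such values differ by at most 2, which is less than \<open>m\<close>. This turns the
  congruences of Euler's criterion into equations.\<close>

lemma unit_cong_imp_eq:
  fixes a b m :: int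
  assumes "[a = b] (mod m)" "2 < m" "a \<in> {-1, 0, 1}" "b \<in> {-1, 0, 1}"
  shows "a = b"
proof -
  have "m dvd a - b" using assms(1) by (simp add: cong_iff_dvd_diff)
  moreover have "\<bar>a - b\<bar> < \<bar>m\<bar>" using assms(2-) by auto
  ultimately show ?thesis using dvd_imp_le_int[of "a - b" m] by linarith
qed

lemma chi_mult:
  fixes x y :: "'p::prime_card mod_ring"
  assumes "2 < CARD('p)"
  shows "chi (x * y) = chi x * chi y"
proof (rule unit_cong_imp_eq)
  let ?h = "(CARD('p) - 1) div 2" and ?a = "to_int_mod_ring x" and ?b = "to_int_mod_ring y"
  have "[chi (of_int (?a * ?b) :: 'p mod_ring) = ?a ^ ?h * ?b ^ ?h] (mod int CARD('p))"
    using euler_chi[OF assms, of "?a * ?b"] by (simp only: power_mult_distrib)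
  moreover have "[chi x * chi y = ?a ^ ?h * ?b ^ ?h] (mod int CARD('p))"
    using cong_mult[OF euler_chi[OF assms, of ?a] euler_chi[OF assms, of ?b]] by simp
  ultimately show "[chi (x * y) = chi x * chi y] (mod int CARD('p))"
    by (simp add: cong_def)
  show "chi x * chi y \<in> {-1, 0, 1}"
    using chi_range[of x] chi_range[of y] by auto
  show "2 < int CARD('p)" using assms by simp
qed (rule chi_range)

text \<open>The exponent \<open>(l - 1) / 2\<close> in Euler's criterion is odd, so -1 is a
  nonresidue.\<close>

lemma chi_minus:
  fixes x :: "'p::prime_card mod_ring"
  assumes "CARD('p) mod 4 = 3"
  shows "chi (- x) = - chi x"
proof -
  obtain k where k: "CARD('p) = 4 * k + 3"
    using assms by (metis mult.commute div_mult_mod_eq)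
  then have gt: "2 < CARD('p)" "2 < int CARD('p)" and "odd ((CARD('p) - 1) div 2)"
    by simp_all
  then have "[chi (of_int (- 1) :: 'p mod_ring) = - 1] (mod int CARD('p))"
    using euler_chi[OF gt(1), of "- 1"] by simp
  then have "chi (of_int (- 1) :: 'p mod_ring) = - 1"
    by (rule unit_cong_imp_eq) (use gt chi_range[of "- 1 :: 'p mod_ring"] in simp_all)
  then show ?thesis
    using chi_mult[OF gt(1), of "- 1" x] by simp
qed

lemma sum_chi:
  assumes "CARD('p::prime_card) mod 4 = 3"
  shows "(\<Sum>x\<in>UNIV. chi (x :: 'p mod_ring)) = 0"
proof -
  have "(\<Sum>x\<in>UNIV. chi (x :: 'p mod_ring)) = (\<Sum>x\<in>UNIV. chi (- x :: 'p mod_ring))"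
    by (rule sum.reindex_bij_witness[of _ uminus uminus]) auto
  then show ?thesis by (simp add: chi_minus[OF assms] sum_negf)
qed

lemma card_chi_not_minus_one:
  assumes "CARD('p::prime_card) mod 4 = 3"
  shows "2 * card {x :: 'p mod_ring. chi x \<noteq> -1} = CARD('p) + 1"
proof -
  \<comment> \<open>Twice the indicator of \<open>chi x \<noteq> -1\<close> is
    \<open>1 + chi x\<close>, corrected by 1 at \<open>x = 0\<close>; the character sum then
    vanishes.\<close>
  have "(\<Sum>x\<in>UNIV. 2 * of_bool (chi (x :: 'p mod_ring) \<noteq> -1) :: int) =
      (\<Sum>x\<in>UNIV. 1 + chi (x :: 'p mod_ring) + of_bool (x = 0))"
    by (rule sum.cong) (use chi_range in \<open>auto simp: of_bool_def\<close>)
  also have "\<dots> = int (CARD('p) + 1)"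
    by (simp add: sum.distrib sum_chi[OF assms])
  finally show ?thesis
    by (simp flip: sum_distrib_left)
qed

subsection \<open>Discrete Fourier transform of binary words\<close>

lemma char_two_add_self:
  assumes "CHAR('k::ring_1) = 2"
  shows "x + x = (0 :: 'k)"
  using assms uminus_CHAR_2[of x] by (metis add.right_inverse)

text \<open>Here \<open>z x\<close> stands for \<open>\<zeta> ^ x\<close>. Injectivity expresses
  that \<open>\<zeta>\<close> is primitive, and \<open>sum_residues\<close> is the coefficient
  condition on the residue polynomial, read as a sum of its roots.\<close>

locale qr_character =
  fixes z :: "'p::prime_card mod_ring \<Rightarrow> 'k::field"
  assumes card_mod_8: "CARD('p) mod 8 = 7"
    and char_two: "CHAR('k) = 2"
    and z_add: "z (x + y) = z x * z y"
    and inj_z: "inj z"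
    and sum_residues: "(\<Sum>x | chi x = 1. z x) = 0"
begin

lemma card_mod_4: "CARD('p) mod 4 = 3"
  using card_mod_8 by presburger

lemma card_gt: "CARD('p) > 2"
  using card_mod_4 by presburger

lemma z_0 [simp]: "z 0 = 1"
proof -
  have "z 0 * z 0 = z 0"
    using z_add[of 0 0] by simp
  moreover have "z 0 \<noteq> 0"
  proof
    assume "z 0 = 0"
    then have "z 1 = z 0" using z_add[of 0 1] by simp
    then show False using inj_z by (auto dest: injD)
  qed
  ultimately show ?thesis by simp
qed

lemma z_of_nat_mult: "z (of_nat n * x) = z x ^ n"
  by (induction n) (simp_all add: z_add algebra_simps)

lemma two_eq_0: "(2 :: 'k) = 0"
  using char_two_add_self[OF char_two, of 1] by simp

text \<open>\<open>l\<close> is odd, so Fourier inversion carries no normalising factor.\<close>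

lemma of_nat_card: "(of_nat CARD('p) :: 'k) = 1"
proof -
  have "odd CARD('p)"
    using card_mod_8 by presburger
  then obtain k where "CARD('p) = 2 * k + 1"
    by (rule oddE)
  then show ?thesis by (simp add: two_eq_0)
qed

text \<open>Shifting the summation variable by 1 multiplies the sum by \<open>z y\<close>, which
  differs from 1.\<close>

lemma sum_z:
  assumes "y \<noteq> 0"
  shows "(\<Sum>x\<in>UNIV. z (x * y)) = 0"
proof -
  let ?S = "\<Sum>x\<in>UNIV. z (x * y)"
  have "?S = (\<Sum>x\<in>UNIV. z ((x + 1) * y))"
    by (rule sum.reindex_bij_witness[of _ "\<lambda>x. x + 1" "\<lambda>x. x - 1"]) auto
  also have "\<dots> = z y * ?S"
    by (simp add: distrib_right z_add sum_distrib_left mult.commute[of "z y"])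
  finally have "(1 - z y) * ?S = 0"
    by (simp add: algebra_simps)
  moreover have "z y \<noteq> 1"
    using assms inj_z by (auto simp flip: z_0 dest: injD)
  ultimately show ?thesis by simp
qed

lemma sum_nonresidues: "(\<Sum>x | chi x = - 1. z x) = 1"
proof -
  have U: "UNIV = {0} \<union> {x :: 'p mod_ring. chi x = 1} \<union> {x. chi x = - 1}"
    using chi_range by auto
  have "(\<Sum>x\<in>UNIV. z x) = 1 + (\<Sum>x | chi x = 1. z x) + (\<Sum>x | chi x = - 1. z x)"
    by (subst U, subst sum.union_disjoint, simp, simp, force, subst sum.union_disjoint) auto
  then have "1 + (\<Sum>x | chi x = - 1. z x) = 0"
    using sum_z[of 1] by (simp add: sum_residues)
  then show ?thesis
    using char_two by (simp add: add_eq_0_iff uminus_CHAR_2)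
qed

lemma sum_chi_class_mult:
  assumes "x \<noteq> 0"
  shows "(\<Sum>q | chi q = e. z (q * x)) = (\<Sum>q | chi q = e * chi x. z q)"
proof (rule sum.reindex_bij_witness[of _ "\<lambda>q. q / x" "\<lambda>q. q * x"])
  fix q :: "'p mod_ring" assume "q \<in> {q. chi q = e * chi x}"
  then have "chi (q / x) * chi x = e * chi x"
    using assms by (simp flip: chi_mult[OF card_gt])
  then show "q / x \<in> {q. chi q = e}"
    using assms by simp
qed (use assms in \<open>auto simp: chi_mult[OF card_gt]\<close>)

text \<open>At 0 the sum counts \<open>(l + 1) / 2\<close> terms, an even number. Elsewhere it is 1
  from \<open>q = 0\<close> plus the sum over the class of \<open>x\<close>, which is 0 for residues
  and 1 for nonresidues.\<close>

lemma sum_nonneg_class: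
  "(\<Sum>q | chi q \<noteq> - 1. z (q * x)) = (if chi x = 1 then 1 else 0)"
proof (cases "x = 0")
  case True
  have "2 * card {x :: 'p mod_ring. chi x \<noteq> -1} = CARD('p) + 1"
    by (rule card_chi_not_minus_one[OF card_mod_4])
  then have "even (card {x :: 'p mod_ring. chi x \<noteq> -1})"
    using card_mod_8 by presburger
  then show ?thesis
    using True two_eq_0 by (auto elim!: evenE)
next
  case False
  have "{q. chi q \<noteq> - 1} = {0} \<union> {q :: 'p mod_ring. chi q = 1}"
    using chi_range by auto
  then have "(\<Sum>q | chi q \<noteq> - 1. z (q * x)) = 1 + (\<Sum>q | chi q = chi x. z q)"
    using sum_chi_class_mult[OF False, of 1] by simp
  moreover have "chi x = 1 \<or> chi x = - 1"
    using False chi_range[of x] by auto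
  ultimately show ?thesis
    using two_eq_0 by (auto simp: sum_residues sum_nonresidues)
qed

text \<open>If 2 were a nonresidue, squaring the vanishing sum over the residues would give the sum over
  the nonresidues, which is 1.\<close>

lemma chi_two: "chi (2 :: 'p mod_ring) = 1"
proof (rule ccontr)
  assume "chi (2 :: 'p mod_ring) \<noteq> 1"
  moreover have "(2 :: 'p mod_ring) \<noteq> 0"
    using card_gt by (metis dvd_imp_le not_less of_nat_numeral zero_less_numeral of_nat_0_mod_ring_dvd)
  ultimately have "chi (2 :: 'p mod_ring) = - 1"
    using chi_range[of "2 :: 'p mod_ring"] by auto
  moreover have "(\<Sum>q | chi q = 1. z (q * 2)) = (\<Sum>q | chi q = 1. z q) ^ 2"
  proof -
    have "z (q * 2) = z q ^ 2" for q
      using z_of_nat_mult[of 2 q] by (simp add: mult.commute)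
    moreover have "(\<Sum>q\<in>A. z q ^ 2) = (\<Sum>q\<in>A. z q) ^ 2" for A
      by (induction A rule: infinite_finite_induct) (simp_all add: power2_sum two_eq_0)
    ultimately show ?thesis by simp
  qed
  ultimately show False
    using sum_chi_class_mult[OF \<open>2 \<noteq> 0\<close>, of 1] by (simp add: sum_residues sum_nonresidues)
qed

definition emb :: "bit \<Rightarrow> 'k" where
  "emb = bit_embed"

lemma emb_0 [simp]: "emb 0 = 0" and emb_1 [simp]: "emb 1 = 1"
  by (simp_all add: emb_def bit_embed_def)

sublocale emb: field_hom emb
proof
  show "emb (x + y) = emb x + emb y" "emb (x * y) = emb x * emb y" for x y
    by (cases x; cases y; simp add: two_eq_0)+
qed simp_all

text \<open>The value at \<open>z x\<close> of the polynomial attached to the word, as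
  \<open>poly_word\<close> confirms.\<close>

definition fourier :: "bit ^ 'p mod_ring \<Rightarrow> 'p mod_ring \<Rightarrow> 'k" where
  "fourier c x = (\<Sum>i\<in>UNIV. emb (c $ i) * z (i * x))"

lemma fourier_add: "fourier (c + d) x = fourier c x + fourier d x"
  by (simp only: fourier_def emb.hom_add vector_add_component distrib_right sum.distrib)

text \<open>Fourier inversion: by orthogonality, summing \<open>z (- k * x) * fourier c x\<close>
  over \<open>x\<close> recovers the entry at \<open>k\<close>.\<close>

lemma fourier_eq_0_imp:
  assumes "\<And>x. fourier c x = 0"
  shows "c = 0"
proof -
  have "c $ k = 0" for k
  proof -
    have "0 = (\<Sum>x\<in>UNIV. z (- k * x) * fourier c x)"
      using assms by simp
    also have "\<dots> = (\<Sum>x\<in>UNIV. \<Sum>i\<in>UNIV. emb (c $ i) * z (x * (i - k)))"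
      unfolding fourier_def sum_distrib_left
      by (intro sum.cong refl) (simp add: mult.left_commute algebra_simps flip: z_add)
    also have "\<dots> = (\<Sum>i\<in>UNIV. emb (c $ i) * (\<Sum>x\<in>UNIV. z (x * (i - k))))"
      by (subst sum.swap) (simp add: sum_distrib_left)
    also have "\<dots> = (\<Sum>i\<in>UNIV. if i = k then emb (c $ i) else 0)"
      by (intro sum.cong refl) (auto simp: sum_z of_nat_card)
    finally show ?thesis by simp
  qed
  then show ?thesis by (simp add: vec_eq_iff)
qed

text \<open>The code described by its zeros; \<open>cyclic_code_eq_qr_code\<close> identifies it
  with the ideal generated by the nonresidue polynomial.\<close>

definition qr_code :: "(bit ^ 'p mod_ring) set" where
  "qr_code = {c. \<forall>x. chi x = - 1 \<longrightarrow> fourier c x = 0}"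

definition residue_word :: "'p mod_ring \<Rightarrow> bit ^ 'p mod_ring" where
  "residue_word i = (\<chi> j. if chi (j - i) = - 1 then 0 else 1)"

text \<open>Translation by \<open>i\<close> multiplies the transform by \<open>z (i * x)\<close>,
  which reduces the claim to \<open>sum_nonneg_class\<close>.\<close>

lemma fourier_residue_word:
  "fourier (residue_word i) x = (if chi x = 1 then z (i * x) else 0)"
proof -
  have "fourier (residue_word i) x = (\<Sum>j\<in>UNIV. if chi (j - i) = - 1 then 0 else z (j * x))"
    unfolding fourier_def by (intro sum.cong) (auto simp: residue_word_def)
  also have "\<dots> = (\<Sum>q\<in>UNIV. if chi q = - 1 then 0 else z ((q + i) * x))"
    by (rule sum.reindex_bij_witness[of _ "\<lambda>q. q + i" "\<lambda>j. j - i"]) auto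
  also have "\<dots> = (\<Sum>q | chi q \<noteq> - 1. z (i * x) * z (q * x))"
    by (simp add: sum.If_cases distrib_right z_add mult.commute[of "z (i * x)"] Collect_neg_eq)
  finally show ?thesis
    by (simp add: sum_nonneg_class flip: sum_distrib_left)
qed

lemma fourier_one: "fourier 1 x = (if x = 0 then 1 else 0)"
  by (simp add: fourier_def sum_z of_nat_card)

lemma qr_code_memb:
  "0 \<in> qr_code" "1 \<in> qr_code" "residue_word i \<in> qr_code"
  "c \<in> qr_code \<Longrightarrow> d \<in> qr_code \<Longrightarrow> c + d \<in> qr_code"
  by (auto simp: qr_code_def fourier_add fourier_one fourier_residue_word)
    (simp add: fourier_def)

text \<open>The all-ones word plus the word of the nonnegative residues is the idempotent generating
  the code: its transform is 1 away from the nonresidues and 0 on them.\<close>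

lemma qr_code_idempotent:
  assumes "c \<in> qr_code"
  shows "c $ j = (\<Sum>i\<in>UNIV. c $ i * (residue_word i $ j + 1))"
proof -
  define d :: "bit ^ 'p mod_ring" where "d = (\<chi> j. \<Sum>i\<in>UNIV. c $ i * (residue_word i $ j + 1))"
  have "fourier d x = fourier c x" for x
  proof -
    have "fourier d x = (\<Sum>j\<in>UNIV. \<Sum>i\<in>UNIV. emb (c $ i) * (emb (residue_word i $ j) * z (j * x) + z (j * x)))"
      unfolding fourier_def d_def
      by (simp only: vec_lambda_beta emb.hom_sum emb.hom_mult emb.hom_add emb_1 sum_distrib_right
        mult.assoc distrib_right mult_1_left)
    also have "\<dots> = (\<Sum>i\<in>UNIV. emb (c $ i) * (fourier (residue_word i) x + fourier 1 x))"
      by (subst sum.swap) (simp add: fourier_def sum.distrib flip: sum_distrib_left)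
    \<comment> \<open>Off the nonresidues the bracket equals \<open>z (i * x)\<close>: the first
      summand supplies it at residues, the second at 0. At nonresidues both vanish.\<close>
    also have "\<dots> = (if chi x = - 1 then 0 else fourier c x)"
      using chi_range[of x] by (auto simp: fourier_residue_word fourier_one fourier_def[of c x])
    also have "\<dots> = fourier c x"
      using assms by (auto simp: qr_code_def)
    finally show ?thesis .
  qed
  then have "fourier (c + d) x = 0" for x
    using char_two_add_self[OF char_two] by (simp add: fourier_add)
  then have "c + d = 0" by (rule fourier_eq_0_imp)
  then have "c $ j + d $ j = 0" by (metis vector_add_component zero_index)
  then have "c $ j = d $ j" by (cases "c $ j"; cases "d $ j") auto
  then show ?thesis by (simp add: d_def)
qed

end

subsection \<open>The cyclic code of the nonresidue polynomial\<close>

lemma prod_linear_factors_dvd: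
  fixes p :: "'k::field poly"
  assumes "finite A" "inj_on f A" "\<And>a. a \<in> A \<Longrightarrow> poly p (f a) = 0"
  shows "(\<Prod>a\<in>A. [:- f a, 1:]) dvd p"
  using assms
proof (induction A rule: finite_induct)
  case (insert a A)
  then obtain q where q: "p = (\<Prod>a\<in>A. [:- f a, 1:]) * q"
    by (auto simp: dvd_def)
  have "poly (\<Prod>a\<in>A. [:- f a, 1:]) (f a) \<noteq> 0"
    using insert by (auto simp: poly_prod)
  then have "[:- f a, 1:] dvd q"
    using insert.prems(2)[of a] q by (simp add: poly_eq_0_iff_dvd)
  then show ?case
    unfolding q prod.insert[OF insert.hyps] mult.commute[of _ q] by (intro mult_dvd_mono) simp_all
qed simp

text \<open>Vieta's formula for the coefficient just below the leading one; it converts the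
  hypothesis on the residue polynomial into a sum of powers of \<open>\<zeta>\<close>.\<close>

lemma coeff_prod_linear_factors:
  fixes f :: "'b \<Rightarrow> 'k::field"
  assumes "card A = Suc n"
  shows "Polynomial.coeff (\<Prod>a\<in>A. [:- f a, 1:]) n = - (\<Sum>a\<in>A. f a)"
proof -
  have deg: "degree (\<Prod>a\<in>A. [:- f a, 1:]) = card A" for A :: "'b set"
    by (cases "finite A") (simp_all add: degree_prod_eq_sum_degree)
  have lc: "Polynomial.coeff (\<Prod>a\<in>A. [:- f a, 1:]) (card A) = 1" for A :: "'b set"
    using lead_coeff_prod[of "\<lambda>a. [:- f a, 1:]" A] by (simp add: deg)
  have "finite A" using assms by (simp add: card_ge_0_finite)
  then show ?thesis using assms
  proof (induction A arbitrary: n rule: finite_induct)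
    case (insert a A)
    show ?case
    proof (cases n)
      case 0
      then show ?thesis using insert by simp
    next
      case (Suc m)
      then show ?thesis using insert lc[of A] by simp
    qed
  qed simp
qed

lemma to_int_mod_ring_nonneg: "0 \<le> to_int_mod_ring (x :: 'p::prime_card mod_ring)"
  and to_int_mod_ring_less: "to_int_mod_ring (x :: 'p::prime_card mod_ring) < int CARD('p)"
  using range_to_int_mod_ring[where 'a='p] by (metis atLeastLessThan_iff rangeI)+

lemma of_nat_nat_to_int_mod_ring [simp]:
  "of_nat (nat (to_int_mod_ring x)) = (x :: 'p::prime_card mod_ring)"
  by (metis of_int_of_nat_eq int_nat_eq of_int_to_int_mod_ring to_int_mod_ring_nonneg)

lemma to_int_mod_ring_of_nat:
  "j < CARD('p) \<Longrightarrow> to_int_mod_ring (of_nat j :: 'p::prime_card mod_ring) = int j"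
  by (simp add: of_nat_of_int_mod_ring)

context qr_character
begin

sublocale emb_poly: map_poly_inj_idom_hom emb ..

definition qpoly :: "int \<Rightarrow> 'k poly" where
  "qpoly e = (\<Prod>x | chi x = e. [:- z x, 1:])"

lemma two_neq_0: "(2 :: 'p mod_ring) \<noteq> 0"
  using chi_two by force

lemma chi_half: "chi (x / 2) = chi (x :: 'p mod_ring)"
  using chi_mult[OF card_gt, of 2 "x / 2"] two_neq_0 chi_two by simp

text \<open>Since 2 is a residue, the Frobenius map permutes the roots of \<open>qpoly e\<close>.\<close>

lemma qpoly_coeff_square: "Polynomial.coeff (qpoly e) n ^ 2 = Polynomial.coeff (qpoly e) n"
proof -
  interpret sq: comm_ring_hom "\<lambda>c::'k. c ^ 2"
    by standard (simp_all add: power2_sum two_eq_0 power_mult_distrib)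
  interpret map_poly_comm_ring_hom "\<lambda>c::'k. c ^ 2" ..
  have "map_poly (\<lambda>c. c ^ 2) (qpoly e) = (\<Prod>x | chi x = e. [:- z (2 * x), 1:])"
    using z_of_nat_mult[of 2] by (simp add: qpoly_def hom_prod char_two uminus_CHAR_2)
  also have "\<dots> = qpoly e"
    unfolding qpoly_def
    by (rule prod.reindex_bij_witness[of _ "\<lambda>x. x / 2" "\<lambda>x. 2 * x"])
      (auto simp: chi_mult[OF card_gt] chi_two two_neq_0 chi_half)
  finally have "Polynomial.coeff (map_poly (\<lambda>c. c ^ 2) (qpoly e)) n = Polynomial.coeff (qpoly e) n" by simp
  then show ?thesis by (simp add: coeff_map_poly)
qed

text \<open>A field element equal to its own square is 0 or 1, so every coefficient lies in the
  prime field.\<close>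

lemma qpoly_descent: "\<exists>g. map_poly emb g = qpoly e"
proof
  have "Polynomial.coeff (qpoly e) n = 0 \<or> Polynomial.coeff (qpoly e) n = 1" for n
    using qpoly_coeff_square[of e n] by (simp add: power2_eq_square)
  then show "map_poly emb (map_poly (\<lambda>c. if c = 1 then 1 else 0) (qpoly e)) = qpoly e"
    by (auto simp: poly_eq_iff coeff_map_poly)
qed

text \<open>Justifies the definite description in \<open>f_minus\<close>: a preimage exists by
  descent and is unique because the embedding is injective.\<close>

lemma map_poly_f_minus:
  assumes "qr_poly CARD('p) (- 1) \<zeta> = qpoly (- 1)"
  shows "map_poly emb (f_minus CARD('p) \<zeta>) = qpoly (- 1)"
proof -
  obtain g where g: "map_poly emb g = qpoly (- 1)"
    using qpoly_descent by blast
  have "h = g" if "map_poly emb h = qpoly (- 1)" for h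
    using that g by (intro emb_poly.injectivity) simp
  with g show ?thesis
    unfolding f_minus_def assms emb_def[symmetric] by (rule theI)
qed

lemma poly_word: "poly (map_poly emb (word_poly c)) (z x) = fourier c x"
proof -
  have "z x ^ nat (to_int_mod_ring i) = z (i * x)" for i
    using z_of_nat_mult[of "nat (to_int_mod_ring i)" x] by simp
  then show ?thesis
    unfolding fourier_def word_poly_def
    by (simp add: emb_poly.hom_sum poly_sum map_poly_monom poly_monom)
qed

text \<open>Every \<open>z x\<close> is a root of \<open>X ^ l - 1\<close>, so multiples of
  \<open>g\<close> modulo that polynomial vanish at the roots of \<open>g\<close>. Conversely,
  vanishing at these distinct roots gives divisibility over the extension field.\<close>

lemma cyclic_code_eq_qr_code:
  assumes "map_poly emb g = qpoly (- 1)"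
  shows "cyclic_code g = qr_code"
proof (intro equalityI subsetI)
  fix c :: "bit ^ 'p mod_ring"
  assume "c \<in> cyclic_code g"
  then obtain q where "[word_poly c = q * g] (mod (Polynomial.monom 1 CARD('p) - 1))"
    by (auto simp: cyclic_code_def)
  then obtain r where "word_poly c - q * g = (Polynomial.monom 1 CARD('p) - 1) * r"
    unfolding cong_iff_dvd_diff by (rule dvdE)
  then have "word_poly c = (Polynomial.monom 1 CARD('p) - 1) * r + q * g"
    by (metis diff_add_cancel)
  then have "map_poly emb (word_poly c) = (Polynomial.monom 1 CARD('p) - 1) * map_poly emb r + map_poly emb q * qpoly (- 1)"
    by (simp add: emb_poly.hom_add emb_poly.hom_mult emb_poly.hom_minus assms map_poly_monom)
  moreover have "z x ^ CARD('p) = 1" for x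
    using z_of_nat_mult[of "CARD('p)" x] by simp
  moreover have "chi x = - 1 \<Longrightarrow> poly (qpoly (- 1)) (z x) = 0" for x
    by (auto simp: qpoly_def poly_prod)
  ultimately show "c \<in> qr_code"
    by (auto simp: qr_code_def poly_monom simp flip: poly_word)
next
  fix c :: "bit ^ 'p mod_ring"
  assume "c \<in> qr_code"
  then have "qpoly (- 1) dvd map_poly emb (word_poly c)"
    unfolding qpoly_def
    by (intro prod_linear_factors_dvd) (auto simp: poly_word qr_code_def intro: inj_on_subset[OF inj_z])
  \<comment> \<open>Divisibility descends along a homomorphism of fields.\<close>
  then have "g dvd word_poly c"
    using emb.dvd_map_poly_hom_imp_dvd by (simp flip: assms)
  then obtain q where "word_poly c = g * q"
    by (rule dvdE)
  then have "[word_poly c = q * g] (mod (Polynomial.monom 1 CARD('p) - 1))"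
    by (simp add: mult.commute)
  then show "c \<in> cyclic_code g"
    unfolding cyclic_code_def by blast
qed

end

lemma qr_poly_eq_prod:
  "qr_poly CARD('p) e \<zeta> =
    (\<Prod>x | chi (x :: 'p::prime_card mod_ring) = e. [:- (\<zeta> ^ nat (to_int_mod_ring x)), 1:])"
  unfolding qr_poly_def
  by (rule prod.reindex_bij_witness[of _ "\<lambda>x. nat (to_int_mod_ring x)" of_nat])
    (auto simp: chi_def to_int_mod_ring_of_nat nat_less_iff to_int_mod_ring_less to_int_mod_ring_nonneg)

lemma qr_character_power:
  fixes \<zeta> :: "'k::field"
  assumes "CARD('p::prime_card) mod 8 = 7"
    and "CHAR('k) = 2"
    and prim: "primitive_root_of_unity CARD('p) \<zeta>"
    and coeff: "Polynomial.coeff (qr_poly CARD('p) 1 \<zeta>) ((CARD('p) - 3) div 2) = 0"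
  shows "qr_character (\<lambda>x :: 'p mod_ring. \<zeta> ^ nat (to_int_mod_ring x))"
proof
  let ?z = "\<lambda>x :: 'p mod_ring. \<zeta> ^ nat (to_int_mod_ring x)"
  have one: "\<zeta> ^ CARD('p) = 1" and ne: "0 < k \<Longrightarrow> k < CARD('p) \<Longrightarrow> \<zeta> ^ k \<noteq> 1" for k
    using prim by (auto simp: primitive_root_of_unity_def)
  have red: "\<zeta> ^ (n mod CARD('p)) = \<zeta> ^ n" for n
    by (metis one mod_div_mult_eq mult.commute mult.right_neutral power_add power_mult power_one)
  show z_add: "?z (x + y) = ?z x * ?z y" for x y
    using to_int_mod_ring_nonneg[of x] to_int_mod_ring_nonneg[of y]
    by (simp add: to_int_mod_ring_add nat_mod_distrib nat_add_distrib red power_add)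
  have z0: "\<zeta> \<noteq> 0"
    using one by (metis power_0_left zero_neq_one zero_less_card_finite not_less0)
  show "inj ?z"
  proof (rule injI, rule ccontr)
    fix x y :: "'p mod_ring"
    assume "?z x = ?z y" "x \<noteq> y"
    have "?z (x - y) * ?z y = ?z y"
      using z_add[of "x - y" y] \<open>?z x = ?z y\<close> by simp
    then have "?z (x - y) = 1"
      using z0 by simp
    moreover have "to_int_mod_ring (x - y) \<noteq> 0"
      using \<open>x \<noteq> y\<close> of_int_to_int_mod_ring[of "x - y"] by (metis of_int_0 right_minus_eq)
    ultimately show False
      using ne[of "nat (to_int_mod_ring (x - y))"] to_int_mod_ring_nonneg[of "x - y"]
        to_int_mod_ring_less[of "x - y"] by (auto simp: nat_less_iff)
  qed
  have "2 * card {x :: 'p mod_ring. chi x \<noteq> -1} = CARD('p) + 1"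
    using assms by (intro card_chi_not_minus_one) presburger
  moreover have "{x :: 'p mod_ring. chi x \<noteq> -1} = insert 0 {x. chi x = 1}"
    using chi_range by auto
  \<comment> \<open>There are \<open>(l - 1) / 2\<close> residues, so the exponent
    \<open>(l - 3) / 2\<close> is one below the degree and Vieta's formula applies.\<close>
  ultimately have "card {x :: 'p mod_ring. chi x = 1} = Suc ((CARD('p) - 3) div 2)"
    using assms(1) by simp
  from coeff_prod_linear_factors[OF this, of ?z] coeff
  show "(\<Sum>x | chi x = 1. ?z x) = 0"
    by (simp add: qr_poly_eq_prod)
qed (fact assms)+

subsection \<open>The ideal and its action\<close>

lemma group_closure_least:
  assumes "A \<subseteq> G" "0 \<in> G" "\<And>x y. x \<in> G \<Longrightarrow> y \<in> G \<Longrightarrow> x - y \<in> G"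
  shows "group_closure A \<subseteq> G"
proof
  fix x assume "x \<in> group_closure A"
  then show "x \<in> G"
    by induction (use assms in auto)
qed

lemma group_closure_sum_mem:
  assumes "\<And>i. i \<in> I \<Longrightarrow> f i \<in> group_closure A"
  shows "(\<Sum>i\<in>I. f i) \<in> group_closure A"
  using assms by (induction I rule: infinite_finite_induct) (auto intro: group_closure_add)

lemma diff_closed_of_int_scaleR:
  fixes x :: "'a::real_vector"
  assumes "0 \<in> G" and diff: "\<And>x y. x \<in> G \<Longrightarrow> y \<in> G \<Longrightarrow> x - y \<in> G" and x: "x \<in> G"
  shows "of_int n *\<^sub>R x \<in> G"
proof -
  have neg: "- y \<in> G" if "y \<in> G" for y
    using diff[OF assms(1) that] by simp
  have nat: "of_nat k *\<^sub>R x \<in> G" for k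
  proof (induction k)
    case (Suc k)
    show ?case using diff[OF Suc neg[OF x]] by (simp add: algebra_simps)
  qed (simp add: assms(1))
  show ?thesis
    by (cases n rule: int_cases2) (use nat neg in auto)
qed

lemma sum_option:
  "(\<Sum>\<mu>\<in>UNIV. f \<mu>) = f None + (\<Sum>x\<in>UNIV. f (Some (x :: 'b::finite)))"
  by (simp add: UNIV_option_conv sum.reindex)

lemma int_vec_component [simp]: "int_vec a $ \<mu> = of_int (a $ \<mu>)"
  by (simp add: int_vec_def)

lemma int_vec_add: "int_vec (a + b) = int_vec a + int_vec b"
  and int_vec_diff: "int_vec (a - b) = int_vec a - int_vec b"
  and int_vec_0: "int_vec 0 = 0"
  by (simp_all add: vec_eq_iff)

lemma int_vec_sum: "int_vec (\<Sum>i\<in>I. f i) = (\<Sum>i\<in>I. int_vec (f i))"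
  by (induction I rule: infinite_finite_induct) (simp_all add: int_vec_add int_vec_0)

section \<open>The quadratic order and its ideal as integer spans\<close>

text \<open>Since 8 divides \<open>l + 1\<close>, the constant term \<open>(l + 1) / 4\<close> is
  twice an integer. This form shows that the square lies in the span of 2 and
  \<open>half_gen l\<close>.\<close>

lemma half_gen_square:
  assumes "l mod 8 = 7"
  shows "half_gen l * half_gen l = half_gen l - 2 * of_int (int ((l + 1) div 8))"
proof -
  obtain k where l: "l = 8 * k + 7"
    using assms by (metis mult.commute div_mult_mod_eq)
  have "half_gen l * half_gen l = half_gen l + (csqrt (- of_nat l) ^ 2 - 1) / 4"
    unfolding half_gen_def power2_eq_square by (simp add: field_simps del: csqrt_of_real_nonpos)
  also have "csqrt (- of_nat l) ^ 2 = - (8 * of_nat k + 7)"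
    unfolding power2_csqrt by (simp add: l)
  also have "half_gen l + (- (8 * of_nat k + 7) - 1) / 4 = half_gen l - 2 * (of_nat k + 1)"
    by (simp add: field_simps)
  finally have "half_gen l * half_gen l = half_gen l - 2 * (of_nat k + 1)" .
  then show ?thesis by (simp add: l)
qed

lemma quad_order_eq:
  assumes "l mod 8 = 7"
  shows "quad_order l = {of_int x + of_int y * half_gen l | x y. True}"
proof (intro equalityI subsetI)
  fix \<alpha> assume "\<alpha> \<in> quad_order l"
  then obtain p :: "int poly" where "\<alpha> = poly (map_poly of_int p) (half_gen l)"
    by (auto simp: quad_order_def)
  moreover have "\<exists>x y. poly (map_poly of_int p) (half_gen l) = of_int x + of_int y * half_gen l"
  proof (induction p)
    case 0
    show ?case by (intro exI[of _ 0]) simp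
  next
    case (pCons a p)
    then obtain x y where "poly (map_poly of_int p) (half_gen l) = of_int x + of_int y * half_gen l"
      by blast
    then have "poly (map_poly of_int (pCons a p)) (half_gen l)
        = of_int a + of_int x * half_gen l + of_int y * (half_gen l * half_gen l)"
      by (simp add: of_int_hom.map_poly_pCons_hom algebra_simps)
    also have "\<dots> = of_int (a - 2 * y * int ((l + 1) div 8)) + of_int (x + y) * half_gen l"
      unfolding half_gen_square[OF assms] by (simp add: algebra_simps)
    finally show ?case by blast
  qed
  ultimately show "\<alpha> \<in> {of_int x + of_int y * half_gen l | x y. True}"
    by auto
next
  fix \<alpha> assume "\<alpha> \<in> {of_int x + of_int y * half_gen l | x y. True}"
  then obtain x y where "\<alpha> = of_int x + of_int y * half_gen l"
    by auto
  then have "\<alpha> = poly (map_poly of_int [:x, y:]) (half_gen l)"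
    by (simp add: of_int_hom.map_poly_pCons_hom mult.commute)
  then show "\<alpha> \<in> quad_order l"
    unfolding quad_order_def by blast
qed

text \<open>Multiplying 2 and \<open>half_gen l\<close> by \<open>half_gen l\<close> does not leave
  their integer span, so that span is already the ideal.\<close>

lemma ideal_P_eq:
  assumes "l mod 8 = 7"
  shows "ideal_P l = {of_int x * 2 + of_int y * half_gen l | x y. True}"
proof (intro equalityI subsetI)
  fix \<alpha> assume "\<alpha> \<in> ideal_P l"
  then obtain x y u v where "\<alpha> = (of_int x + of_int y * half_gen l) * 2 + (of_int u + of_int v * half_gen l) * half_gen l"
    unfolding ideal_P_def quad_order_eq[OF assms] by blast
  also have "\<dots> = of_int x * 2 + of_int (2 * y + u) * half_gen l + of_int v * (half_gen l * half_gen l)"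
    by (simp add: algebra_simps)
  also have "\<dots> = of_int (x - v * int ((l + 1) div 8)) * 2 + of_int (2 * y + u + v) * half_gen l"
    unfolding half_gen_square[OF assms] by (simp add: algebra_simps)
  finally show "\<alpha> \<in> {of_int x * 2 + of_int y * half_gen l | x y. True}"
    by blast
next
  fix \<alpha> assume "\<alpha> \<in> {of_int x * 2 + of_int y * half_gen l | x y. True}"
  then obtain x y where "\<alpha> = of_int x * 2 + of_int y * half_gen l"
    by auto
  moreover have "of_int x \<in> quad_order l" for x
    unfolding quad_order_eq[OF assms] by (rule CollectI, rule exI[of _ x], rule exI[of _ 0]) simp
  ultimately show "\<alpha> \<in> ideal_P l"
    unfolding ideal_P_def by blast
qed

text \<open>The action of \<open>half_gen l\<close> alone, the case \<open>x = 0\<close>,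
  \<open>y = 1\<close> of \<open>quad_act_ideal\<close>.\<close>

definition half_act :: "real ^ ('p::prime_card) coord \<Rightarrow> real ^ 'p coord" where
  "half_act v = (1/2) *\<^sub>R (v + v v* paley)"

lemma half_act_None: "half_act v $ None = (v $ None - (\<Sum>i\<in>UNIV. v $ Some i)) / 2"
  by (simp add: half_act_def vector_matrix_mult_def paley_def sum_option sum_negf)

lemma half_act_Some:
  "half_act v $ Some j = (v $ None + v $ Some j + (\<Sum>i\<in>UNIV. of_int (chi (j - i)) * v $ Some i)) / 2"
  by (simp add: half_act_def vector_matrix_mult_def paley_def sum_option Legendre_eq_chi mult.commute)

lemma quad_act_eq:
  "quad_act \<alpha> v = Re \<alpha> *\<^sub>R v + (Im \<alpha> / sqrt (real CARD('p))) *\<^sub>R (v v* paley)"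
  for v :: "real ^ ('p::prime_card) coord"
proof -
  have "v v* (a *\<^sub>R A + b *\<^sub>R B) = a *\<^sub>R (v v* A) + b *\<^sub>R (v v* B)"
    for a b :: real and A B :: "real ^ 'p coord ^ 'p coord"
    by (simp add: vec_eq_iff vector_matrix_mult_def sum_distrib_left algebra_simps sum.distrib)
  then show ?thesis
    by (simp add: quad_act_def)
qed

lemma quad_act_ideal:
  "quad_act (of_int x * 2 + of_int y * half_gen CARD('p)) v
    = of_int x *\<^sub>R (2 *\<^sub>R v) + of_int y *\<^sub>R half_act v"
  for v :: "real ^ ('p::prime_card) coord"
proof -
  have "half_gen CARD('p) = Complex (1/2) (sqrt (real CARD('p)) / 2)"
    by (simp add: half_gen_def complex_eq_iff)
  then show ?thesis
    by (simp add: quad_act_eq half_act_def algebra_simps)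
qed

definition half_ones :: "real ^ ('p::prime_card) coord" where
  "half_ones = (\<chi> \<mu>. 1/2)"

lemma half_ones_eq:
  "(1/2) *\<^sub>R (axis None 1 v* (mat 1 + paley)) = (half_ones :: real ^ ('p::prime_card) coord)"
proof -
  have "(axis None 1 v* (mat 1 + paley)) $ \<mu> = (1 :: real)" for \<mu> :: "'p coord"
    by (cases \<mu>) (simp_all add: vector_matrix_mult_def axis_def sum_option mat_def paley_def)
  then show ?thesis
    by (simp add: vec_eq_iff half_ones_def)
qed

lemma half_ones_mem: "half_ones \<in> L_plus"
  unfolding L_plus_def half_ones_eq L_zero_def
  by (intro UnI2 image_eqI[of _ _ 0] image_eqI[of _ _ 0]) (simp_all add: int_vec_0)

definition glue :: "real ^ ('p::prime_card) coord" where
  "glue = (1/2) *\<^sub>R (\<chi> \<mu>. case \<mu> of None \<Rightarrow> (1/2) * (1 - real CARD('p)) | Some j \<Rightarrow> 1)"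

text \<open>At finite coordinates the character sum vanishes; at infinity the \<open>l\<close>
  entries -1 of the Paley column produce \<open>(1 - l) / 4\<close>.\<close>

lemma half_act_half_ones:
  assumes "CARD('p) mod 4 = 3"
  shows "half_act half_ones = (glue :: real ^ ('p::prime_card) coord)"
proof -
  have "(\<Sum>i\<in>UNIV. chi (j - i :: 'p mod_ring)) = (\<Sum>x\<in>UNIV. chi (x :: 'p mod_ring))" for j
    by (rule sum.reindex_bij_witness[of _ "\<lambda>x. j - x" "\<lambda>i. j - i"]) auto
  then have "(\<Sum>i\<in>UNIV. of_int (chi (j - i :: 'p mod_ring)) / 2 :: real) = 0" for j
    by (simp add: sum_chi[OF assms] flip: sum_divide_distrib of_int_sum)
  then show ?thesis
    by (auto simp: vec_eq_iff half_act_None half_act_Some half_ones_def glue_def field_simps split: option.split)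
qed

section \<open>Closure properties and generators of \<open>PL_plus\<close>\<close>

lemma PL_plus_zero: "0 \<in> PL_plus"
  and PL_plus_diff: "x \<in> PL_plus \<Longrightarrow> y \<in> PL_plus \<Longrightarrow> x - y \<in> PL_plus"
  and PL_plus_add: "x \<in> PL_plus \<Longrightarrow> y \<in> PL_plus \<Longrightarrow> x + y \<in> PL_plus"
  and PL_plus_sum: "(\<And>i. i \<in> I \<Longrightarrow> f i \<in> PL_plus) \<Longrightarrow> (\<Sum>i\<in>I. f i) \<in> PL_plus"
  unfolding PL_plus_def
  by (auto intro: group_closure.diff group_closure_add group_closure_sum_mem)

lemma PL_plus_generators:
  fixes v :: "real ^ ('p::prime_card) coord"
  assumes "CARD('p) mod 8 = 7" "v \<in> L_plus"
  shows "2 *\<^sub>R v \<in> PL_plus" "half_act v \<in> PL_plus"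
proof -
  have mem: "quad_act (of_int x * 2 + of_int y * half_gen CARD('p)) v \<in> PL_plus" for x y
    unfolding PL_plus_def using assms(2) ideal_P_eq[OF assms(1)]
    by (intro group_closure.base) blast
  show "2 *\<^sub>R v \<in> PL_plus" "half_act v \<in> PL_plus"
    using mem[of 1 0] mem[of 0 1] unfolding quad_act_ideal by simp_all
qed

text \<open>By \<open>ideal_P_eq\<close>, each defining generator is an integer combination of
  \<open>2 *\<^sub>R v\<close> and \<open>half_act v\<close>.\<close>

lemma PL_plus_least:
  fixes G :: "(real ^ ('p::prime_card) coord) set"
  assumes l: "CARD('p) mod 8 = 7"
    and "\<And>v. v \<in> L_plus \<Longrightarrow> 2 *\<^sub>R v \<in> G" "\<And>v. v \<in> L_plus \<Longrightarrow> half_act v \<in> G"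
    and "0 \<in> G" and diff: "\<And>x y. x \<in> G \<Longrightarrow> y \<in> G \<Longrightarrow> x - y \<in> G"
  shows "PL_plus \<subseteq> G"
  unfolding PL_plus_def
proof (rule group_closure_least)
  have add: "x + y \<in> G" if "x \<in> G" "y \<in> G" for x y
    using diff[OF that(1) diff[OF \<open>0 \<in> G\<close> that(2)]] by simp
  show "{quad_act \<alpha> v | \<alpha> v. \<alpha> \<in> ideal_P CARD('p) \<and> v \<in> L_plus} \<subseteq> G"
    unfolding ideal_P_eq[OF l]
    by (auto simp only: quad_act_ideal intro!: add diff_closed_of_int_scaleR[of G, OF assms(4,5)] assms(2,3))
qed (fact assms)+

subsection \<open>The lattice\<close>

lemma of_int_bit_eq_imp_even:
  assumes "of_int x = (of_int y :: bit)"
  shows "even (x - y)"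
proof (rule ccontr)
  assume "odd (x - y)"
  then obtain k where "x - y = 2 * k + 1" by (rule oddE)
  then have "x = y + (2 * k + 1)" by simp
  then have "of_int x = (of_int y + 1 :: bit)" by simp
  then show False
    using assms by (cases "of_int y :: bit") auto
qed

context qr_character
begin

text \<open>The integer vectors of the first claim, with the code given by its zeros.\<close>

definition qr_lattice :: "(int ^ 'p coord) set" where
  "qr_lattice = {a. int_vec a \<in> parity_extend ` qr_code \<and> 4 dvd (\<Sum>\<mu>\<in>UNIV. a $ \<mu>)}"

lemma qr_lattice_zero: "0 \<in> qr_lattice"
proof -
  have "int_vec (0 :: int ^ 'p coord) = parity_extend 0"
    by (simp add: vec_eq_iff parity_extend_def split: option.split)
  then show ?thesis
    using qr_code_memb(1) by (simp add: qr_lattice_def)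
qed

lemma qr_lattice_diff:
  assumes "a \<in> qr_lattice" "b \<in> qr_lattice"
  shows "a - b \<in> qr_lattice"
proof -
  obtain c d where c: "c \<in> qr_code" "int_vec a = parity_extend c"
    and d: "d \<in> qr_code" "int_vec b = parity_extend d"
    using assms by (auto simp: qr_lattice_def)
  have "int_vec (a - b) = (int_vec a + int_vec b :: bit ^ 'p coord)"
    by (simp only: vec_eq_iff int_vec_component vector_minus_component vector_add_component
      of_int_diff minus_bit_def) simp
  also have "\<dots> = parity_extend (c + d)"
    unfolding c d
    by (simp only: vec_eq_iff parity_extend_def vec_lambda_beta vector_add_component sum.distrib)
      (simp split: option.split)
  finally show ?thesis
    using assms qr_code_memb(4)[OF c(1) d(1)] by (auto simp: qr_lattice_def sum_subtractf)
qed

lemma qr_lattice_add: "a \<in> qr_lattice \<Longrightarrow> b \<in> qr_lattice \<Longrightarrow> a + b \<in> qr_lattice"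
  using qr_lattice_diff[OF _ qr_lattice_diff[OF qr_lattice_zero], of a b] by simp

lemma qr_lattice_sum:
  "(\<And>i. i \<in> I \<Longrightarrow> f i \<in> qr_lattice) \<Longrightarrow> (\<Sum>i\<in>I. f i) \<in> qr_lattice"
  by (induction I rule: infinite_finite_induct) (auto intro: qr_lattice_zero qr_lattice_add)

lemma qr_lattice_scale:
  assumes "a \<in> qr_lattice"
  shows "n *s a \<in> qr_lattice"
proof -
  have nat: "int k *s a \<in> qr_lattice" for k
    by (induction k) (simp_all add: assms qr_lattice_zero qr_lattice_add vector_sadd_rdistrib)
  show ?thesis
  proof (cases n rule: int_cases2)
    case (nonpos k)
    have "- int k *s a = 0 - int k *s a"
      by (simp add: vec_eq_iff)
    then show ?thesis
      using qr_lattice_diff[OF qr_lattice_zero nat, of k] nonpos by simp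
  qed (use nat in simp)
qed

lemma double_mem_qr_lattice:
  assumes "even (\<Sum>\<mu>\<in>UNIV. a $ \<mu>)"
  shows "2 *s a \<in> qr_lattice"
proof -
  have "int_vec (2 *s a) = parity_extend 0"
    by (simp add: vec_eq_iff parity_extend_def split: option.split)
  moreover have "4 dvd (\<Sum>\<mu>\<in>UNIV. (2 *s a) $ \<mu>)"
    using assms by (auto simp flip: sum_distrib_left elim!: evenE)
  ultimately show ?thesis
    using qr_code_memb(1) by (simp add: qr_lattice_def)
qed

lemma one_mem_qr_lattice: "1 \<in> qr_lattice"
proof -
  have "odd CARD('p)" "4 dvd int (Suc CARD('p))"
    using card_mod_8 by presburger+
  then have "int_vec (1 :: int ^ 'p coord) = parity_extend 1" "4 dvd (\<Sum>\<mu>\<in>UNIV. (1 :: int ^ 'p coord) $ \<mu>)"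
    by (auto simp: vec_eq_iff parity_extend_def elim!: oddE split: option.split)
  then show ?thesis
    using qr_code_memb(2) by (simp add: qr_lattice_def)
qed

text \<open>The 0-1 lift of the extended \<open>residue_word i\<close>; its entry at infinity is 0
  because the word has even weight.\<close>

definition residue_vec :: "'p mod_ring \<Rightarrow> int ^ 'p coord" where
  "residue_vec i = (\<chi> \<mu>. case \<mu> of None \<Rightarrow> 0 | Some j \<Rightarrow> if chi (j - i) = - 1 then 0 else 1)"

lemma residue_vec_mem: "residue_vec i \<in> qr_lattice"
proof -
  have "{j. chi (j - i) \<noteq> - 1} = (+) i ` {x. chi x \<noteq> - 1}"
    by (force simp: image_iff intro: exI[of _ "_ - i"])
  then have card: "card {j. chi (j - i) \<noteq> - 1} = card {x :: 'p mod_ring. chi x \<noteq> - 1}"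
    by (simp add: card_image)
  have "2 * card {x :: 'p mod_ring. chi x \<noteq> - 1} = CARD('p) + 1"
    by (rule card_chi_not_minus_one[OF card_mod_4])
  then have four: "4 dvd card {j. chi (j - i) \<noteq> - 1}"
    unfolding card using card_mod_8 by presburger
  \<comment> \<open>Stated over any semiring because the same count serves twice: over
    \<open>bit\<close> for the parity coordinate and over the integers modulo 4.\<close>
  have sum: "(\<Sum>j\<in>UNIV. if chi (j - i) = - 1 then 0 else 1 :: 'b::semiring_1)
      = of_nat (card {j. chi (j - i) \<noteq> - 1})"
    by (simp add: sum.If_cases Collect_neg_eq)
  have "int_vec (residue_vec i) $ \<mu> = parity_extend (residue_word i) $ \<mu>" for \<mu>
  proof (cases \<mu>)
    case None
    have "(\<Sum>j\<in>UNIV. residue_word i $ j) = of_nat (card {j. chi (j - i) \<noteq> - 1})"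
      unfolding residue_word_def vec_lambda_beta by (rule sum)
    also have "\<dots> = 0" using four by (auto elim!: dvdE)
    finally show ?thesis
      using None by (simp only: residue_vec_def parity_extend_def int_vec_component vec_lambda_beta) simp
  qed (simp add: residue_vec_def residue_word_def parity_extend_def)
  then have "int_vec (residue_vec i) = parity_extend (residue_word i)"
    by (simp only: vec_eq_iff) simp
  moreover have "4 dvd (\<Sum>\<mu>\<in>UNIV. residue_vec i $ \<mu>)"
    using four int_dvd_int_iff[of 4] by (simp add: residue_vec_def sum_option sum)
  ultimately show ?thesis
    using qr_code_memb(3) by (simp add: qr_lattice_def)
qed

text \<open>By linearity: the unit vector at infinity goes to half the all-ones vector, and the one
  at \<open>i\<close> goes to \<open>residue_vec i\<close> minus that half.\<close>

lemma half_act_int_vec: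
  assumes "a $ None - (\<Sum>i\<in>UNIV. a $ Some i) = 2 * k"
  shows "half_act (int_vec a) = int_vec ((\<Sum>i\<in>UNIV. a $ Some i *s residue_vec i) + k *s 1)"
proof -
  have "half_act (int_vec a) $ \<mu> = int_vec ((\<Sum>i\<in>UNIV. a $ Some i *s residue_vec i) + k *s 1) $ \<mu>" for \<mu>
  proof (cases \<mu>)
    case None
    have "real_of_int (a $ None - (\<Sum>i\<in>UNIV. a $ Some i)) = real_of_int (2 * k)"
      using assms by simp
    then show ?thesis
      by (simp add: None half_act_None residue_vec_def)
  next
    case (Some j)
    have "2 * (if chi (j - i) = - 1 then 0 else 1) = 1 + chi (j - i) + (if i = j then 1 else 0)" for i
      using chi_range[of "j - i"] by auto
    then have "2 * (\<Sum>i\<in>UNIV. a $ Some i * (if chi (j - i) = - 1 then 0 else 1)) =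
        (\<Sum>i\<in>UNIV. a $ Some i * (1 + chi (j - i) + (if i = j then 1 else 0)))"
      by (simp add: sum_distrib_left mult.left_commute[of 2])
    also have "\<dots> = (\<Sum>i\<in>UNIV. a $ Some i) + (\<Sum>i\<in>UNIV. chi (j - i) * a $ Some i) + a $ Some j"
      by (simp add: distrib_left sum.distrib mult.commute if_distrib[of "\<lambda>x. a $ _ * x"] cong: if_cong)
    finally have "2 * ((\<Sum>i\<in>UNIV. a $ Some i * (if chi (j - i) = - 1 then 0 else 1)) + k) =
        a $ None + a $ Some j + (\<Sum>i\<in>UNIV. chi (j - i) * a $ Some i)"
      using assms by simp
    from arg_cong[OF this, of real_of_int] show ?thesis
      by (simp add: Some half_act_Some residue_vec_def sum_component)
  qed
  then show ?thesis by (simp add: vec_eq_iff)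
qed

lemma half_act_mem_qr_lattice:
  assumes "even (\<Sum>\<mu>\<in>UNIV. a $ \<mu>)"
  shows "half_act (int_vec a) \<in> int_vec ` qr_lattice"
proof -
  have "even (a $ None - (\<Sum>i\<in>UNIV. a $ Some i))"
    using assms by (simp add: sum_option)
  then obtain k where k: "a $ None - (\<Sum>i\<in>UNIV. a $ Some i) = 2 * k"
    by (rule evenE)
  show ?thesis
    unfolding half_act_int_vec[OF k]
    by (intro imageI qr_lattice_add qr_lattice_sum qr_lattice_scale residue_vec_mem one_mem_qr_lattice)
qed

lemma two_glue: "\<exists>a\<in>qr_lattice. 2 *\<^sub>R glue = (int_vec a :: real ^ 'p coord)"
proof -
  obtain k where "CARD('p) = 8 * k + 7"
    using card_mod_8 by (metis mult.commute div_mult_mod_eq)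
  \<comment> \<open>The entry at infinity of the doubled glue vector is
    \<open>(1 - l) / 2 = 1 - 2 * (2 * k + 2)\<close>, and \<open>2 * k + 2\<close> is even.\<close>
  moreover define d :: "int ^ 'p coord" where "d = axis None (2 * int k + 2)"
  ultimately have "2 *\<^sub>R glue = (int_vec (1 - 2 *s d) :: real ^ 'p coord)"
    by (simp add: vec_eq_iff glue_def axis_def field_simps split: option.split)
  moreover have "even (\<Sum>\<mu>\<in>UNIV. d $ \<mu>)"
    by (simp add: d_def axis_def)
  ultimately show ?thesis
    using qr_lattice_diff[OF one_mem_qr_lattice double_mem_qr_lattice] by blast
qed

section \<open>Upper bound for \<open>PL_plus\<close>\<close>

text \<open>The right side is a group. Doubling and \<open>half_act\<close> are additive, so it
  suffices to treat \<open>L_zero\<close> and the single vector \<open>half_ones\<close>.\<close>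

lemma PL_plus_subset:
  "PL_plus \<subseteq> {int_vec a + of_int y *\<^sub>R glue | a y. a \<in> qr_lattice}" (is "_ \<subseteq> ?G")
proof (rule PL_plus_least)
  have lattice: "int_vec a \<in> ?G" if "a \<in> qr_lattice" for a
    using that by (intro CollectI exI[of _ a] exI[of _ 0]) simp
  show zero: "0 \<in> ?G"
    using lattice[OF qr_lattice_zero] by (simp add: int_vec_0)
  show diff: "x - y \<in> ?G" if xy: "x \<in> ?G" "y \<in> ?G" for x y
  proof -
    obtain a m b n where "a \<in> qr_lattice" "x = int_vec a + of_int m *\<^sub>R glue"
      "b \<in> qr_lattice" "y = int_vec b + of_int n *\<^sub>R glue"
      using xy by auto
    then have "x - y = int_vec (a - b) + of_int (m - n) *\<^sub>R glue" "a - b \<in> qr_lattice"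
      by (auto simp: int_vec_diff algebra_simps intro: qr_lattice_diff)
    then show ?thesis by blast
  qed
  have add: "x + y \<in> ?G" if "x \<in> ?G" "y \<in> ?G" for x y
    using diff[OF that(1) diff[OF zero that(2)]] by simp
  have zero_part: "2 *\<^sub>R v \<in> ?G" "half_act v \<in> ?G" if "v \<in> L_zero" for v
  proof -
    obtain a :: "int ^ 'p coord" where a: "v = int_vec a" "even (\<Sum>\<mu>\<in>UNIV. a $ \<mu>)"
      using \<open>v \<in> L_zero\<close> by (auto simp: L_zero_def)
    then have "2 *\<^sub>R v = int_vec (2 *s a)"
      by (simp add: vec_eq_iff)
    then show "2 *\<^sub>R v \<in> ?G"
      using lattice[OF double_mem_qr_lattice[OF a(2)]] by simp
    obtain b where "b \<in> qr_lattice" "half_act v = int_vec b"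
      using half_act_mem_qr_lattice[OF a(2)] a(1) by auto
    then show "half_act v \<in> ?G"
      using lattice by simp
  qed
  have "2 *\<^sub>R half_ones = (int_vec 1 :: real ^ 'p coord)"
    by (simp add: vec_eq_iff half_ones_def)
  then have two: "2 *\<^sub>R half_ones \<in> ?G"
    using lattice[OF one_mem_qr_lattice] by simp
  have half: "half_act half_ones \<in> ?G"
    unfolding half_act_half_ones[OF card_mod_4] using qr_lattice_zero
    by (intro CollectI exI[of _ 0] exI[of _ 1]) (simp add: int_vec_0)
  fix v :: "real ^ 'p coord"
  assume "v \<in> L_plus"
  then consider "v \<in> L_zero" | w where "w \<in> L_zero" "v = half_ones + w"
    unfolding L_plus_def half_ones_eq by blast
  then show "2 *\<^sub>R v \<in> ?G" "half_act v \<in> ?G"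
  proof (atomize (full), cases)
    case 2
    have "half_act v = half_act half_ones + half_act w"
      unfolding 2 by (simp add: half_act_def vector_matrix_left_distrib algebra_simps)
    moreover have "2 *\<^sub>R v = 2 *\<^sub>R half_ones + 2 *\<^sub>R w"
      unfolding 2 by (rule scaleR_add_right)
    ultimately show "2 *\<^sub>R v \<in> ?G \<and> half_act v \<in> ?G"
      using add[OF two zero_part(1)[OF 2(1)]] add[OF half zero_part(2)[OF 2(1)]]
      by (simp only: simp_thms)
  qed (intro conjI zero_part)
qed (rule card_mod_8)

section \<open>Lower bound for \<open>PL_plus\<close>\<close>

lemma glue_mem: "glue \<in> (PL_plus :: (real ^ 'p coord) set)"
  using PL_plus_generators(2)[OF card_mod_8 half_ones_mem] half_act_half_ones[OF card_mod_4] by simp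

lemma one_mem_PL_plus: "int_vec 1 \<in> (PL_plus :: (real ^ 'p coord) set)"
proof -
  have "2 *\<^sub>R half_ones = (int_vec 1 :: real ^ 'p coord)"
    by (simp add: vec_eq_iff half_ones_def)
  then show ?thesis
    using PL_plus_generators(1)[OF card_mod_8 half_ones_mem] by simp
qed

lemma int_vec_mem_L_plus:
  "even (\<Sum>\<mu>\<in>UNIV. a $ \<mu>) \<Longrightarrow> int_vec a \<in> L_plus"
  by (auto simp: L_plus_def L_zero_def)

lemma residue_vec_mem_PL_plus: "int_vec (residue_vec i) \<in> (PL_plus :: (real ^ 'p coord) set)"
proof -
  \<comment> \<open>The entry at infinity balances the entry at \<open>i\<close>, so the all-ones
    term of \<open>half_act_int_vec\<close> has coefficient 0.\<close>
  define a :: "int ^ 'p coord" where "a = axis None 1 + axis (Some i) 1"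
  have "half_act (int_vec a) = (int_vec (\<Sum>j\<in>UNIV. a $ Some j *s residue_vec j) :: real ^ 'p coord)"
    using half_act_int_vec[of a 0] by (simp add: a_def axis_def)
  also have "(\<Sum>j\<in>UNIV. a $ Some j *s residue_vec j) = (\<Sum>j\<in>UNIV. if j = i then residue_vec j else 0)"
    by (intro sum.cong) (auto simp: a_def axis_def)
  also have "\<dots> = residue_vec i"
    by simp
  finally have "half_act (int_vec a) = (int_vec (residue_vec i) :: real ^ 'p coord)" .
  moreover have "even (\<Sum>\<mu>\<in>UNIV. a $ \<mu>)"
    by (simp add: a_def axis_def sum.distrib)
  ultimately show ?thesis
    using PL_plus_generators(2)[OF card_mod_8 int_vec_mem_L_plus, of a] by simp
qed

text \<open>The idempotent expansion of the codeword lifts to an integer vector \<open>b\<close> in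
  \<open>PL_plus\<close> congruent to \<open>a\<close> modulo 2. The difference is twice a vector of
  even sum.\<close>

lemma qr_lattice_subset_PL_plus:
  assumes "a \<in> qr_lattice"
  shows "int_vec a \<in> (PL_plus :: (real ^ 'p coord) set)"
proof -
  obtain c where c: "c \<in> qr_code" "int_vec a = parity_extend c"
    using assms by (auto simp: qr_lattice_def)
  define b where "b = (\<Sum>i\<in>{i. c $ i = 1}. residue_vec i + 1)"
  have b_mem: "b \<in> qr_lattice"
    unfolding b_def by (intro qr_lattice_sum qr_lattice_add residue_vec_mem one_mem_qr_lattice)
  have "int_vec b = (\<Sum>i\<in>{i. c $ i = 1}. int_vec (residue_vec i) + int_vec 1 :: real ^ 'p coord)"
    by (simp add: b_def int_vec_sum int_vec_add)
  then have b_PL: "int_vec b \<in> (PL_plus :: (real ^ 'p coord) set)"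
    by (auto intro!: PL_plus_sum PL_plus_add residue_vec_mem_PL_plus one_mem_PL_plus)
  have mod2: "of_int (b $ \<mu>) = (of_int (a $ \<mu>) :: bit)" for \<mu>
  proof -
    have "of_int (b $ \<mu>) = (\<Sum>i\<in>{i. c $ i = 1}. of_int (residue_vec i $ \<mu>) + 1 :: bit)"
      unfolding b_def sum_component of_int_sum vector_add_component of_int_add one_index of_int_1 ..
    also have "\<dots> = (\<Sum>i\<in>UNIV. if c $ i = 1 then of_int (residue_vec i $ \<mu>) + 1 else 0)"
      by (subst sum.inter_filter[symmetric]) simp_all
    also have "\<dots> = (\<Sum>i\<in>UNIV. c $ i * (of_int (residue_vec i $ \<mu>) + 1))"
      by (intro sum.cong refl) auto
    also have "\<dots> = parity_extend c $ \<mu>"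
    proof (cases \<mu>)
      case None
      \<comment> \<open>Each \<open>residue_vec i\<close> is 0 at infinity, so the sum collapses to
        the sum of the entries of \<open>c\<close>, its parity bit.\<close>
      then show ?thesis
        by (simp only: parity_extend_def residue_vec_def vec_lambda_beta option.case of_int_0
          add_0_left mult_1_right)
    next
      case (Some j)
      have "of_int (residue_vec i $ Some j) = residue_word i $ j" for i
        by (simp add: residue_vec_def residue_word_def)
      then show ?thesis
        using qr_code_idempotent[OF c(1), of j]
        by (simp only: Some parity_extend_def vec_lambda_beta option.case)
    qed
    also have "\<dots> = of_int (a $ \<mu>)"
      unfolding c(2)[symmetric] by simp
    finally show ?thesis .
  qed
  define d where "d = (\<chi> \<mu>. (a $ \<mu> - b $ \<mu>) div 2)"
  have "even (a $ \<mu> - b $ \<mu>)" for \<mu>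
    by (rule of_int_bit_eq_imp_even) (simp only: mod2)
  then have ab: "a - b = 2 *s d"
    by (simp add: vec_eq_iff d_def)
  \<comment> \<open>Here the condition modulo 4 enters: it makes the sum of \<open>d\<close> even,
    which places \<open>d\<close> in \<open>L_zero\<close>.\<close>
  have "4 dvd (\<Sum>\<mu>\<in>UNIV. (a - b) $ \<mu>)"
    using qr_lattice_diff[OF assms b_mem] by (simp add: qr_lattice_def)
  then have "even (\<Sum>\<mu>\<in>UNIV. d $ \<mu>)"
    unfolding ab by (auto simp flip: sum_distrib_left elim!: dvdE)
  then have "2 *\<^sub>R int_vec d \<in> (PL_plus :: (real ^ 'p coord) set)"
    by (intro PL_plus_generators(1)[OF card_mod_8] int_vec_mem_L_plus)
  moreover have "a = b + 2 *s d"
    using ab by (metis add.commute diff_add_cancel)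
  then have "int_vec a = int_vec b + (2 *\<^sub>R int_vec d :: real ^ 'p coord)"
    by (simp add: vec_eq_iff)
  ultimately show ?thesis
    using PL_plus_add[OF b_PL] by simp
qed

section \<open>Integral vectors of \<open>PL_plus\<close> and the glue generator\<close>

lemma PL_plus_integral: "PL_plus \<inter> range int_vec = (int_vec ` qr_lattice :: (real ^ 'p coord) set)"
proof (intro equalityI subsetI)
  fix x :: "real ^ 'p coord"
  assume "x \<in> PL_plus \<inter> range int_vec"
  then obtain a y b where a: "a \<in> qr_lattice" and x: "x = int_vec a + of_int y *\<^sub>R glue" and b: "x = int_vec b"
    using PL_plus_subset by blast
  \<comment> \<open>The glue vector has entry 1/2 at every finite coordinate, so integrality at one
    of them forces \<open>y\<close> to be even; \<open>two_glue\<close> then absorbs the glue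
    term.\<close>
  have "x $ Some 0 = of_int (a $ Some 0) + of_int y / 2"
    unfolding x by (simp add: glue_def)
  then have "real_of_int y = real_of_int (2 * (b $ Some 0 - a $ Some 0))"
    by (simp add: b)
  then obtain w where w: "y = 2 * w"
    by (simp only: of_int_eq_iff)
  obtain g where g: "g \<in> qr_lattice" "2 *\<^sub>R glue = (int_vec g :: real ^ 'p coord)"
    using two_glue by blast
  have "of_int y *\<^sub>R glue = of_int w *\<^sub>R (2 *\<^sub>R glue :: real ^ 'p coord)"
    by (simp add: w mult.commute)
  then have "x = int_vec (a + w *s g)"
    unfolding x g(2) by (simp add: vec_eq_iff)
  then show "x \<in> int_vec ` qr_lattice"
    using qr_lattice_add[OF a qr_lattice_scale[OF g(1)]] by blast
qed (use qr_lattice_subset_PL_plus in blast)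

lemma PL_plus_eq_closure:
  "(PL_plus :: (real ^ 'p coord) set) = group_closure ((PL_plus \<inter> range int_vec) \<union> {glue})" (is "_ = ?C")
proof
  show "PL_plus \<subseteq> ?C"
  proof
    fix x :: "real ^ 'p coord" assume "x \<in> PL_plus"
    then obtain a y where "a \<in> qr_lattice" and x: "x = int_vec a + of_int y *\<^sub>R glue"
      using PL_plus_subset by blast
    then have "int_vec a \<in> ?C"
      unfolding PL_plus_integral by (auto intro: group_closure.base)
    moreover have "of_int y *\<^sub>R glue \<in> ?C"
      by (rule diff_closed_of_int_scaleR) (auto intro: group_closure.intros)
    ultimately show "x \<in> ?C"
      unfolding x by (rule group_closure_add)
  qed
  show "?C \<subseteq> PL_plus"
    by (rule group_closure_least) (auto intro: glue_mem PL_plus_zero PL_plus_diff)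
qed

end

theorem theorem4p5:
  fixes l :: nat and \<zeta> :: "'k::field"
  assumes "l = CARD('p::prime_card)"
    and "prime l" and "l mod 8 = 7"
    and "CHAR('k) = 2"
    and "primitive_root_of_unity l \<zeta>"
    and "Polynomial.coeff (qr_poly l 1 \<zeta>) ((l - 3) div 2) = 0"
  shows "(PL_plus :: (real ^ 'p coord) set) \<inter> range int_vec =
           int_vec ` {a :: int ^ 'p coord.
             int_vec a \<in> extended_qr_code \<zeta> \<and> 4 dvd (\<Sum>\<mu>\<in>UNIV. a $ \<mu>)}
       \<and> (PL_plus :: (real ^ 'p coord) set) =
           group_closure ((PL_plus \<inter> range int_vec) \<union>
             {(1/2) *\<^sub>R (\<chi> \<mu>. case \<mu> of None \<Rightarrow> (1/2) * (1 - real l) | Some j \<Rightarrow> 1)})"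
proof -
  interpret qr_character "\<lambda>x :: 'p mod_ring. \<zeta> ^ nat (to_int_mod_ring x)"
    using assms by (intro qr_character_power) simp_all
  have "qr_poly CARD('p) (- 1) \<zeta> = qpoly (- 1)"
    unfolding qpoly_def by (rule qr_poly_eq_prod)
  then have "cyclic_code (f_minus CARD('p) \<zeta>) = qr_code"
    by (intro cyclic_code_eq_qr_code map_poly_f_minus)
  \<comment> \<open>With the cyclic code identified, the locale's lattice becomes the set in the
    statement.\<close>
  then have "qr_lattice = {a. int_vec a \<in> extended_qr_code \<zeta> \<and> 4 dvd (\<Sum>\<mu>\<in>UNIV. a $ \<mu>)}"
    by (simp add: qr_lattice_def extended_qr_code_def)
  then show ?thesis
    using PL_plus_integral PL_plus_eq_closure unfolding glue_def assms(1) by (simp only: simp_thms)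
qed

end
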